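(* For every integer $n \geq 3$, $$\gamma_s(M_{2n}) = \begin{cases} \dfrac{3n}{4} & \text{if } n \equiv 4 \pmod 8,\\[2mm] \left\lceil \dfrac{3n+1}{4} \right\rceil & \text{otherwise.}\end{cases}$$
   Context: All graphs are finite, simple and undirected. A set $S\subseteq V(G)$ is dominating in $G$ if every vertex of $G$ not in $S$ has a neighbour in $S$. A set $S\subseteq V(G)$ is secure dominating in $G$ if for every vertex $v\notin S$ there is a vertex $w\in S$ adjacent to $v$ such that $(S\setminus\{w\})\cup\{v\}$ is a dominating set of $G$. The secure domination number $\gamma_s(G)$ is the minimum cardinality of a secure dominating set of $G$. For $n\ge 3$, $M_{2n}$ denotes the Möbius ladder graph on $2n$ vertices: it has vertices $v^i_1, v^i_2$ for $1\le i\le n$ and edges $v^i_1v^i_2$ for $1\le i\le n$, $v^i_jv^{i+1}_j$ for $1\le i\le n-1$ and $j\in\{1,2\}$, together with the two "twisted" edges $v^n_1v^1_2$ and $v^n_2v^1_1$. *)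

theory Defs
  imports Complex_Main "Graph_Theory.Pair_Digraph"
begin

(* An undirected simple graph is a symmetric, loop-free, finite pair digraph (locale pair_graph);
   vertices v and w are adjacent iff (v, w) is in parcs G. *)

definition dominating :: "'a pair_pre_digraph \<Rightarrow> 'a set \<Rightarrow> bool" where
  "dominating G S \<longleftrightarrow>
     S \<subseteq> pverts G \<and> (\<forall>v \<in> pverts G - S. \<exists>w \<in> S. (v, w) \<in> parcs G)"

definition secure_dominating :: "'a pair_pre_digraph \<Rightarrow> 'a set \<Rightarrow> bool" where
  "secure_dominating G S \<longleftrightarrow>
     S \<subseteq> pverts G \<and>
     (\<forall>v \<in> pverts G - S. \<exists>w \<in> S. (v, w) \<in> parcs G \<and> dominating G ((S - {w}) \<union> {v}))"

definition secure_domination_number :: "'a pair_pre_digraph \<Rightarrow> nat" where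
  "secure_domination_number G = (LEAST k. \<exists>S. secure_dominating G S \<and> card S = k)"

lemma secure_dominating_pverts: "secure_dominating G (pverts G)"
  by (simp add: secure_dominating_def)

lemma secure_domination_number_attained:
  "\<exists>S. secure_dominating G S \<and> card S = secure_domination_number G"
  unfolding secure_domination_number_def
  by (rule LeastI_ex) (use secure_dominating_pverts in blast)

(* The pair (i, j) stands for the vertex v^i_j. Each edge is listed once, in one orientation. *)

definition moebius_edges :: "nat \<Rightarrow> ((nat \<times> nat) \<times> (nat \<times> nat)) set" where
  "moebius_edges n =
     {((i, 1), (i, 2)) | i. 1 \<le> i \<and> i \<le> n} \<union>
     {((i, j), (i + 1, j)) | i j. 1 \<le> i \<and> i + 1 \<le> n \<and> j \<in> {1, 2}} \<union>
     {((n, 1), (1, 2)), ((n, 2), (1, 1))}"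

(* moebius_ladder n has 2 * n vertices, i.e. it is the graph usually written M_(2n). *)

definition moebius_ladder :: "nat \<Rightarrow> (nat \<times> nat) pair_pre_digraph" where
  "moebius_ladder n =
     \<lparr> pverts = {1..n} \<times> {1, 2}, parcs = moebius_edges n \<union> (moebius_edges n)\<inverse> \<rparr>"

lemma pair_graph_moebius_ladder:
  assumes "n \<ge> 3"
  shows "pair_graph (moebius_ladder n)"
proof
  show "finite (pverts (moebius_ladder n))"
    by (simp add: moebius_ladder_def)
  show "symmetric (with_proj (moebius_ladder n))"
    by (simp add: symmetric_def moebius_ladder_def sym_Un_converse)
next
  fix e assume e: "e \<in> parcs (moebius_ladder n)"
  show "fst e \<in> pverts (moebius_ladder n)" "snd e \<in> pverts (moebius_ladder n)"
       "fst e \<noteq> snd e"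
    using assms e by (auto simp: moebius_ladder_def moebius_edges_def)
next
  have "parcs (moebius_ladder n) \<subseteq> pverts (moebius_ladder n) \<times> pverts (moebius_ladder n)"
    using assms by (auto simp: moebius_ladder_def moebius_edges_def)
  then show "finite (parcs (moebius_ladder n))"
    by (rule finite_subset) (simp add: moebius_ladder_def)
qed

end

theory Submission
  imports Defs
begin

text \<open>
  The graph is triangle-free, so a guard \<open>w\<close> can move to \<open>v\<close> iff no vertex other than \<open>v\<close> is dominated
  by \<open>w\<close> alone. Secure domination thus amounts to a local condition on a labelling of the vertices by
  four roles. Walking along the two rails, which form one cycle of length \<open>2 * n\<close>, turns such a labelling
  into an infinite sequence of columns that is swapped after \<open>n\<close> steps and in which only three consecutive
  columns constrain each other.

  For the lower bound every guard receives charge 8 and passes part of it to the adjacent columns so that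
  each column ends up with at least 6; hence \<open>6 * n \<le> 8 * card S\<close>. If all columns end up with
  exactly 6, then a column with a free guard reappears swapped four columns later, which fits the twist
  after \<open>n\<close> columns only if \<open>n\<close> is an odd multiple of 4. The upper bound glues optimal blocks of four
  columns with three guards, and at most four further columns with one guard each.
\<close>

section \<open>Secure domination in triangle-free graphs\<close>

text \<open>
  A guard is \<open>Tied\<close> if some vertex outside the set has it as its only guard, and \<open>Free\<close> otherwise. An
  unguarded vertex is \<open>Own\<close> (the private neighbour of a tied guard) if it has exactly one guard as neighbour,
  and \<open>Shared\<close> if it has several.
\<close>

datatype role = Free | Tied | Own | Shared

fun guard :: "role \<Rightarrow> bool" where
  "guard Free = True" | "guard Tied = True" | "guard Own = False" | "guard Shared = False"

definition neighbours :: "'a pair_pre_digraph \<Rightarrow> 'a \<Rightarrow> 'a set" where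
  "neighbours G v = {w. (v, w) \<in> parcs G}"

definition triangle_free :: "'a pair_pre_digraph \<Rightarrow> bool" where
  "triangle_free G \<longleftrightarrow> (\<forall>x y z. (x, y) \<in> parcs G \<longrightarrow> (y, z) \<in> parcs G \<longrightarrow> (x, z) \<notin> parcs G)"

lemma (in pair_graph) neighbours_sym: "x \<in> neighbours G y \<Longrightarrow> y \<in> neighbours G x"
  using arcs_symmetric[of y x] by (simp add: neighbours_def)

lemma (in pair_graph) neighbours_verts: "x \<in> neighbours G y \<Longrightarrow> x \<in> pverts G"
  using in_arcsD2[of y x] by (simp add: neighbours_def)

text \<open>When \<open>w\<close> moves to \<open>v\<close>, only neighbours of \<open>w\<close> can
  lose their guard. Such a neighbour cannot be rescued by \<open>v\<close>, as that would close a
  triangle, so it needs a second guard in \<open>S\<close>.\<close>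

lemma secure_dominating_triangle_free:
  assumes G: "pair_graph G" and tf: "triangle_free G"
  shows "secure_dominating G S \<longleftrightarrow> S \<subseteq> pverts G \<and>
    (\<forall>v \<in> pverts G - S. \<exists>w \<in> neighbours G v \<inter> S.
       \<forall>x \<in> neighbours G w - S - {v}. \<exists>y \<in> neighbours G x \<inter> S. y \<noteq> w)" (is "_ \<longleftrightarrow> ?R")
proof -
  have sym: "(x, y) \<in> parcs G \<Longrightarrow> (y, x) \<in> parcs G" for x y
    using pair_graph.neighbours_sym[OF G, of y x] by (simp add: neighbours_def)
  have verts: "(x, y) \<in> parcs G \<Longrightarrow> y \<in> pverts G" for x y
    using pair_graph.neighbours_verts[OF G, of y x] by (simp add: neighbours_def)
  note tf' = tf[unfolded triangle_free_def, rule_format]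
  show ?thesis
  proof
    assume S: "secure_dominating G S"
    have "\<exists>w \<in> neighbours G v \<inter> S. \<forall>x \<in> neighbours G w - S - {v}. \<exists>y \<in> neighbours G x \<inter> S. y \<noteq> w"
      if v: "v \<in> pverts G - S" for v
    proof -
      obtain w where w: "w \<in> S" "(v, w) \<in> parcs G" "dominating G (S - {w} \<union> {v})"
        using S v unfolding secure_dominating_def by blast
      have "\<exists>y \<in> neighbours G x \<inter> S. y \<noteq> w" if x: "x \<in> neighbours G w - S - {v}" for x
      proof -
        have "(w, x) \<in> parcs G" using x by (simp add: neighbours_def)
        \<comment> \<open>An edge from \<open>x\<close> to \<open>v\<close> would form a triangle
          with \<open>w\<close>.\<close>
        then have "x \<in> pverts G - (S - {w} \<union> {v})" "(x, v) \<notin> parcs G"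
          using x verts[of w x] tf'[OF w(2)] sym[of x v] w(1) by blast+
        then obtain y where "y \<in> S - {w} \<union> {v}" "(x, y) \<in> parcs G"
          using w(3) unfolding dominating_def by blast
        then show ?thesis
          using \<open>(x, v) \<notin> parcs G\<close> by (auto simp: neighbours_def)
      qed
      then show ?thesis
        using w by (auto simp: neighbours_def)
    qed
    then show ?R
      using S unfolding secure_dominating_def by blast
  next
    assume R: ?R
    have "\<exists>w \<in> S. (v, w) \<in> parcs G \<and> dominating G (S - {w} \<union> {v})" if v: "v \<in> pverts G - S" for v
    proof -
      obtain w where w: "w \<in> S" "(v, w) \<in> parcs G"
        and epn: "\<And>x. x \<in> neighbours G w - S - {v} \<Longrightarrow> \<exists>y \<in> neighbours G x \<inter> S. y \<noteq> w"
        using R v unfolding neighbours_def by blast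
      have "\<exists>y \<in> S - {w} \<union> {v}. (x, y) \<in> parcs G" if x: "x \<in> pverts G - (S - {w} \<union> {v})" for x
      proof -
        have "(w, v) \<in> parcs G" using w(2) by (rule sym)
        consider "x = w" | "x \<in> neighbours G w - S - {v}" | "x \<in> pverts G - S" "x \<notin> neighbours G w"
          using x by blast
        then show ?thesis
        proof cases
          case 1
          then show ?thesis using \<open>(w, v) \<in> parcs G\<close> by blast
        next
          case 2
          then show ?thesis using epn[of x] unfolding neighbours_def by blast
        next
          case 3
          then obtain y where y: "y \<in> S" "(x, y) \<in> parcs G"
            using R unfolding neighbours_def by blast
          then have "y \<noteq> w" using 3(2) sym[OF y(2)] unfolding neighbours_def by blast
          then show ?thesis using y by blast
        qed
      qed
      moreover have "S - {w} \<union> {v} \<subseteq> pverts G" using R v by blast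
      ultimately show ?thesis
        using w unfolding dominating_def by blast
    qed
    then show "secure_dominating G S"
      using R unfolding secure_dominating_def by blast
  qed
qed

text \<open>A guard with two private neighbours could defend neither, hence the uniqueness for
  \<open>Tied\<close>. A \<open>Shared\<close> vertex needs a \<open>Free\<close> defender, since a
  tied guard moving to it would abandon its private neighbour.\<close>

fun role_rule :: "('a \<Rightarrow> role) \<Rightarrow> 'a set \<Rightarrow> role \<Rightarrow> bool" where
  "role_rule L N Free \<longleftrightarrow> (\<forall>x \<in> N. L x \<noteq> Own)"
| "role_rule L N Tied \<longleftrightarrow> (\<exists>!x. x \<in> N \<and> L x = Own)"
| "role_rule L N Own \<longleftrightarrow> (\<exists>!x. x \<in> N \<and> guard (L x)) \<and> (\<exists>x \<in> N. L x = Tied)"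
| "role_rule L N Shared \<longleftrightarrow>
     (\<exists>x \<in> N. \<exists>y \<in> N. x \<noteq> y \<and> guard (L x) \<and> guard (L y)) \<and> (\<exists>x \<in> N. L x = Free)"

definition role_assignment :: "'a pair_pre_digraph \<Rightarrow> ('a \<Rightarrow> role) \<Rightarrow> bool" where
  "role_assignment G L \<longleftrightarrow> (\<forall>v \<in> pverts G. role_rule L (neighbours G v) (L v))"

text \<open>Every unguarded vertex has a defender without any other private neighbour. This makes
  private neighbours unique and the defenders of shared vertices free.\<close>

lemma secure_dominating_imp_role_assignment:
  assumes G: "pair_graph G" "triangle_free G" and S: "secure_dominating G S"
  shows "\<exists>L. role_assignment G L \<and> S = {v \<in> pverts G. guard (L v)}"
proof -
  note sym = pair_graph.neighbours_sym[OF G(1)] and verts = pair_graph.neighbours_verts[OF G(1)]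
  \<comment> \<open>\<open>v\<close> is an external private neighbour of \<open>w\<close>.\<close>
  define own where "own v w \<longleftrightarrow> v \<notin> S \<and> w \<in> S \<and> neighbours G v \<inter> S = {w}" for v w
  define L where "L v = (if v \<in> S then if \<exists>x. own x v then Tied else Free
                         else if \<exists>w. own v w then Own else Shared)" for v
  have S_sub: "S \<subseteq> pverts G" using S by (simp add: secure_dominating_def)
  have guard: "guard (L v) \<longleftrightarrow> v \<in> S" for v by (simp add: L_def)
  have Own: "L v = Own \<longleftrightarrow> (\<exists>w. own v w)" for v by (auto simp: L_def own_def)
  have Tied: "L v = Tied \<longleftrightarrow> (\<exists>x. own x v)" for v by (auto simp: L_def own_def)
  have Free: "L v = Free \<longleftrightarrow> v \<in> S \<and> (\<nexists>x. own x v)" for v by (auto simp: L_def own_def)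
  have own_nbr: "w \<in> neighbours G x \<and> x \<in> neighbours G w" if "own x w" for x w
    using that sym unfolding own_def by blast
  have defender: "\<exists>w \<in> neighbours G v \<inter> S. \<forall>x. own x w \<longrightarrow> x = v" if v: "v \<in> pverts G" "v \<notin> S" for v
  proof -
    obtain w where "w \<in> neighbours G v \<inter> S"
      and w: "\<And>x. x \<in> neighbours G w - S - {v} \<Longrightarrow> \<exists>y \<in> neighbours G x \<inter> S. y \<noteq> w"
      using S v unfolding secure_dominating_triangle_free[OF G] by blast
    moreover have "x = v" if "own x w" for x
      using w[of x] own_nbr[OF that] that unfolding own_def by blast
    ultimately show ?thesis by blast
  qed
  have own_unique: "x = y" if "own x w" "own y w" for x y w
  proof -
    have "x \<in> pverts G" using own_nbr[OF that(1)] verts by blast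
    \<comment> \<open>The defender of \<open>x\<close> can only be its sole guard
      \<open>w\<close>.\<close>
    then obtain w' where "w' \<in> neighbours G x \<inter> S" "\<forall>z. own z w' \<longrightarrow> z = x"
      using defender \<open>own x w\<close> own_def by metis
    moreover from this have "w' = w" using \<open>own x w\<close> unfolding own_def by blast
    ultimately show ?thesis using \<open>own y w\<close> by blast
  qed
  have own_at: "own x v" if Lx: "L x = Own" and x: "x \<in> neighbours G v" and v: "v \<in> S" for x v
  proof -
    obtain w where w: "own x w" using Own Lx by blast
    moreover have "v \<in> neighbours G x \<inter> S" using sym x v by blast
    ultimately have "v = w" unfolding own_def by blast
    then show ?thesis using w by simp
  qed
  have "role_rule L (neighbours G v) (L v)" if v: "v \<in> pverts G" for v
  proof (cases "L v")
    case c: Free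
    then have "L x \<noteq> Own" if "x \<in> neighbours G v" for x
      using own_at[OF _ that] Free by blast
    then show ?thesis
      using c by simp
  next
    case c: Tied
    then obtain x where x: "own x v" using Tied by blast
    have "y = x" if "y \<in> neighbours G v" "L y = Own" for y
      using own_unique[OF own_at x] that x own_def by blast
    moreover have "x \<in> neighbours G v" "L x = Own" using Own own_nbr x by blast+
    ultimately have "\<exists>!x. x \<in> neighbours G v \<and> L x = Own" by blast
    then show ?thesis
      using c by simp
  next
    case c: Own
    then obtain w where w: "own v w" using Own by blast
    then have "neighbours G v \<inter> S = {w}" by (simp add: own_def)
    then have "\<exists>!x. x \<in> neighbours G v \<and> guard (L x)"
      unfolding guard by (metis IntI IntD1 IntD2 insertI1 singletonD)
    moreover have "L w = Tied" using Tied w by blast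
    moreover have "w \<in> neighbours G v" using own_nbr w by blast
    ultimately show ?thesis
      using c by auto
  next
    case c: Shared
    then have "v \<notin> S" "\<nexists>w. own v w" using Own guard by force+
    then obtain w where w: "w \<in> neighbours G v" "w \<in> S" "\<forall>x. own x w \<longrightarrow> x = v"
      using defender v by blast
    then have "L w = Free" using Free \<open>\<nexists>w. own v w\<close> by blast
    moreover obtain y where "y \<in> neighbours G v" "y \<in> S" "y \<noteq> w"
      using w \<open>v \<notin> S\<close> \<open>\<nexists>w. own v w\<close> unfolding own_def by blast
    ultimately show ?thesis
      using c w guard by auto
  qed
  moreover have "S = {v \<in> pverts G. guard (L v)}"
    using S_sub guard by blast
  ultimately show ?thesis
    unfolding role_assignment_def by blast
qed

text \<open>The tied neighbour defends an \<open>Own\<close> vertex and a free neighbour a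
  \<open>Shared\<close> one. All other unguarded neighbours of that defender are
  \<open>Shared\<close>, so they keep another guard.\<close>

lemma role_assignment_imp_secure_dominating:
  assumes G: "pair_graph G" "triangle_free G" and L: "role_assignment G L"
  shows "secure_dominating G {v \<in> pverts G. guard (L v)}"
proof -
  note sym = pair_graph.neighbours_sym[OF G(1)] and verts = pair_graph.neighbours_verts[OF G(1)]
  let ?S = "{v \<in> pverts G. guard (L v)}"
  have rule: "role_rule L (neighbours G v) (L v)" if "v \<in> pverts G" for v
    using L that by (simp add: role_assignment_def)
  have shared: "\<exists>y \<in> neighbours G x \<inter> ?S. y \<noteq> w" if "x \<in> pverts G" "L x = Shared" for x w
  proof -
    obtain y z where "y \<in> neighbours G x" "z \<in> neighbours G x" "y \<noteq> z" "guard (L y)" "guard (L z)"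
      using rule[of x] \<open>x \<in> pverts G\<close> \<open>L x = Shared\<close> by auto
    then have "y \<in> neighbours G x \<inter> ?S" "z \<in> neighbours G x \<inter> ?S" using verts by simp_all
    then show ?thesis using \<open>y \<noteq> z\<close> by metis
  qed
  have "\<exists>w \<in> neighbours G v \<inter> ?S. \<forall>x \<in> neighbours G w - ?S - {v}. \<exists>y \<in> neighbours G x \<inter> ?S. y \<noteq> w"
    if v: "v \<in> pverts G - ?S" for v
  proof -
    have "\<exists>w \<in> neighbours G v \<inter> ?S. \<forall>x \<in> neighbours G w - {v}. L x \<noteq> Own"
    proof (cases "L v")
      case Own
      then obtain w where w: "w \<in> neighbours G v" "L w = Tied" using rule v by fastforce
      then have "\<exists>!x. x \<in> neighbours G w \<and> L x = Own" using rule[of w] verts by simp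
      then have "\<forall>x \<in> neighbours G w - {v}. L x \<noteq> Own" using w sym Own by blast
      then show ?thesis using w verts by (intro bexI[of _ w]) auto
    next
      case Shared
      then obtain w where w: "w \<in> neighbours G v" "L w = Free" using rule v by fastforce
      then have "\<forall>x \<in> neighbours G w. L x \<noteq> Own" using rule[of w] verts by simp
      then show ?thesis using w verts by (intro bexI[of _ w]) auto
    qed (use v in auto)
    then obtain w where w: "w \<in> neighbours G v \<inter> ?S" "\<forall>x \<in> neighbours G w - {v}. L x \<noteq> Own"
      by blast
    have "L x = Shared" if "x \<in> neighbours G w - ?S - {v}" for x
      using w(2) that verts by (cases "L x") auto
    then show ?thesis
      using w(1) shared verts by blast
  qed
  then show ?thesis
    unfolding secure_dominating_triangle_free[OF G] by blast
qed

section \<open>Unrolling the Moebius ladder\<close>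

definition exactly_one :: "bool \<Rightarrow> bool \<Rightarrow> bool \<Rightarrow> bool" where
  "exactly_one x y z \<longleftrightarrow> (x \<and> \<not> y \<and> \<not> z) \<or> (\<not> x \<and> y \<and> \<not> z) \<or> (\<not> x \<and> \<not> y \<and> z)"
text \<open>\<open>role_rule\<close> for a vertex of degree three, in a form that can be
  evaluated.\<close>

fun fits :: "role \<Rightarrow> role \<Rightarrow> role \<Rightarrow> role \<Rightarrow> bool" where
  "fits Free x y z \<longleftrightarrow> x \<noteq> Own \<and> y \<noteq> Own \<and> z \<noteq> Own"
| "fits Tied x y z \<longleftrightarrow> exactly_one (x = Own) (y = Own) (z = Own)"
| "fits Own x y z \<longleftrightarrow> exactly_one (guard x) (guard y) (guard z) \<and> (x = Tied \<or> y = Tied \<or> z = Tied)"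
| "fits Shared x y z \<longleftrightarrow> (guard x \<and> guard y \<or> guard x \<and> guard z \<or> guard y \<and> guard z)
      \<and> (x = Free \<or> y = Free \<or> z = Free)"
type_synonym column = "role \<times> role"
fun legal :: "column \<Rightarrow> column \<Rightarrow> column \<Rightarrow> bool" where
  "legal (a, a') (b, b') (c, c') \<longleftrightarrow> fits b a c b' \<and> fits b' a' c' b"
fun guards :: "column \<Rightarrow> nat" where
  "guards (a, a') = of_bool (guard a) + of_bool (guard a')"

lemma legal_swap: "legal (prod.swap a) (prod.swap b) (prod.swap c) \<longleftrightarrow> legal a b c"
  by (cases a; cases b; cases c) auto

lemma guards_swap: "guards (prod.swap a) = guards a"
  by (cases a) simp

lemma role_rule_three:
  assumes "distinct [a, b, c]"
  shows "role_rule L {a, b, c} r \<longleftrightarrow> fits r (L a) (L b) (L c)"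
  using assms by (cases r) (auto simp: exactly_one_def)

fun step :: "nat \<Rightarrow> nat \<times> nat \<Rightarrow> nat \<times> nat" where
  "step n (i, j) = (if i = n then (1, 3 - j) else (i + 1, j))"

text \<open>The vertices in the order in which a walk along the rails meets them; the period is \<open>2 * n\<close>.\<close>

definition unroll :: "nat \<Rightarrow> nat \<Rightarrow> nat \<times> nat" where
  "unroll n k = (k mod n + 1, if even (k div n) then 1 else 2)"

lemma unroll_Suc: "n > 0 \<Longrightarrow> unroll n (Suc k) = step n (unroll n k)"
  by (auto simp: unroll_def mod_Suc div_Suc)

lemma unroll_add: "n > 0 \<Longrightarrow> unroll n (k + n) = (fst (unroll n k), 3 - snd (unroll n k))"
  by (simp add: unroll_def)

lemma unroll_in_pverts: "n > 0 \<Longrightarrow> unroll n k \<in> pverts (moebius_ladder n)"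
  using mod_less_divisor[of n k] by (auto simp: unroll_def moebius_ladder_def simp del: mod_less_divisor)

lemma neighbours_moebius:
  assumes "n \<ge> 3" "(i, j) \<in> pverts (moebius_ladder n)"
  shows "neighbours (moebius_ladder n) (i, j) =
    {(if i = 1 then (n, 3 - j) else (i - 1, j)), step n (i, j), (i, 3 - j)}"
  using assms by (auto simp: neighbours_def moebius_ladder_def moebius_edges_def)

lemma triangle_free_moebius:
  assumes "n \<ge> 3"
  shows "triangle_free (moebius_ladder n)"
proof -
  interpret pair_graph "moebius_ladder n" using assms by (rule pair_graph_moebius_ladder)
  have "neighbours (moebius_ladder n) (i, j) \<inter> neighbours (moebius_ladder n) y = {}"
    if v: "(i, j) \<in> pverts (moebius_ladder n)" and y: "y \<in> neighbours (moebius_ladder n) (i, j)" for i j y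
  proof -
    have j: "j = 1 \<or> j = 2" and i: "1 \<le> i" "i \<le> n"
      using v by (auto simp: moebius_ladder_def)
    have pv: "(i, j) \<in> pverts (moebius_ladder n) \<longleftrightarrow> 1 \<le> i \<and> i \<le> n \<and> (j = 1 \<or> j = 2)" for i j
      by (auto simp: moebius_ladder_def)
    have y_cases: "y = (if i = 1 then (n, 3 - j) else (i - 1, j)) \<or> y = step n (i, j) \<or> y = (i, 3 - j)"
      using y unfolding neighbours_moebius[OF assms v] by blast
    \<comment> \<open>The twisted edges affect only the first and the last column.\<close>
    consider "i = 1" | "i = n" | i' where "i = Suc i'" "1 \<le> i'" "Suc i' < n"
      using i by (cases i) fastforce+
    then show ?thesis
      using y_cases j assms
      by cases (elim disjE; simp add: neighbours_moebius pv; linarith?)+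
  qed
  then show ?thesis
    unfolding triangle_free_def neighbours_def using in_arcsD1 by fast
qed

text \<open>Walking \<open>n\<close> steps leads to the other end of the same rung, so the twist no
  longer needs a case distinction. The successor index provides a predecessor on the walk.\<close>

lemma neighbours_unroll:
  assumes "n \<ge> 3"
  shows "neighbours (moebius_ladder n) (unroll n (Suc k)) = {unroll n k, unroll n (Suc (Suc k)), unroll n (Suc k + n)}"
    and "distinct [unroll n k, unroll n (Suc (Suc k)), unroll n (Suc k + n)]"
proof -
  obtain i j where ij: "unroll n k = (i, j)" by force
  have v: "(i, j) \<in> pverts (moebius_ladder n)" "step n (i, j) \<in> pverts (moebius_ladder n)"
    using unroll_in_pverts[of n k] unroll_in_pverts[of n "Suc k"] assms by (simp_all add: ij unroll_Suc)
  have n: "n > 0" using assms by simp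
  have j: "j \<noteq> 3 - j" "3 - (3 - j) = j" and i: "1 \<le> i" "i \<le> n"
    using v(1) by (auto simp: moebius_ladder_def)
  have "neighbours (moebius_ladder n) (step n (i, j)) =
      {(i, j), step n (step n (i, j)), (fst (step n (i, j)), 3 - snd (step n (i, j)))}
    \<and> distinct [(i, j), step n (step n (i, j)), (fst (step n (i, j)), 3 - snd (step n (i, j)))]"
  proof (cases "i = n")
    case True
    then show ?thesis
      using neighbours_moebius[OF assms, of 1 "3 - j"] v(2) i j assms by simp
  next
    case False
    then show ?thesis
      using neighbours_moebius[OF assms, of "i + 1" j] v(2) i j assms by simp
  qed
  then show "neighbours (moebius_ladder n) (unroll n (Suc k)) = {unroll n k, unroll n (Suc (Suc k)), unroll n (Suc k + n)}"
    and "distinct [unroll n k, unroll n (Suc (Suc k)), unroll n (Suc k + n)]"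
    unfolding unroll_add[OF n] unroll_Suc[OF n] ij by blast+
qed

lemma pverts_moebius_unroll:
  assumes "n > 0"
  shows "pverts (moebius_ladder n) = range (\<lambda>k. unroll n (Suc k))"
proof
  show "range (\<lambda>k. unroll n (Suc k)) \<subseteq> pverts (moebius_ladder n)"
    using unroll_in_pverts assms by blast
  show "pverts (moebius_ladder n) \<subseteq> range (\<lambda>k. unroll n (Suc k))"
  proof
    fix v assume "v \<in> pverts (moebius_ladder n)"
    then obtain i j where v: "v = (Suc i, j)" "i < n" "j = 1 \<or> j = 2"
      by (auto simp: moebius_ladder_def Suc_le_eq gr0_conv_Suc)
    \<comment> \<open>A full period is added on the first rail because \<open>i\<close> may be 0
      while the index must be a successor.\<close>
    define k where "k = (if j = 1 then i + n + n else i + n)"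
    have "v = unroll n k"
      using v assms by (auto simp: unroll_def k_def)
    moreover have "k > 0" using assms by (simp add: k_def)
    ultimately show "v \<in> range (\<lambda>k. unroll n (Suc k))"
      by (auto simp: image_iff gr0_conv_Suc)
  qed
qed

section \<open>Role assignments as infinite column sequences\<close>

definition twisted :: "nat \<Rightarrow> (nat \<Rightarrow> column) \<Rightarrow> bool" where
  "twisted n c \<longleftrightarrow> (\<forall>k. c (k + n) = prod.swap (c k)) \<and> (\<forall>k. legal (c k) (c (Suc k)) (c (Suc (Suc k))))"

lemma role_assignment_unroll:
  assumes "n \<ge> 3" and c: "\<And>k. c k = (L (unroll n k), L (unroll n (k + n)))"
  shows "role_assignment (moebius_ladder n) L \<longleftrightarrow> twisted n c"
proof -
  have n: "n > 0" using assms by simp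
  have "unroll n (k + n + n) = unroll n k" for k
    by (simp add: unroll_def n)
  then have per: "c (k + n) = prod.swap (c k)" for k by (simp add: c)
  have three: "role_rule L {unroll n k, unroll n (Suc (Suc k)), unroll n (Suc k + n)} r \<longleftrightarrow>
      fits r (L (unroll n k)) (L (unroll n (Suc (Suc k)))) (L (unroll n (Suc k + n)))" for k r
    by (rule role_rule_three[OF neighbours_unroll(2)[OF assms(1)]])
  have "role_assignment (moebius_ladder n) L \<longleftrightarrow>
     (\<forall>k. fits (fst (c (Suc k))) (fst (c k)) (fst (c (Suc (Suc k)))) (snd (c (Suc k))))"
    unfolding role_assignment_def pverts_moebius_unroll[OF n]
    by (simp add: neighbours_unroll(1)[OF assms(1)] three c del: add_Suc)
  also have "\<dots> \<longleftrightarrow> (\<forall>k. legal (c k) (c (Suc k)) (c (Suc (Suc k))))" (is "?A \<longleftrightarrow> ?B")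
  proof
    assume A: ?A
    show ?B
    proof
      fix k
      show "legal (c k) (c (Suc k)) (c (Suc (Suc k)))"
        \<comment> \<open>The second entry of a column is the first entry \<open>n\<close> columns
          later, so its condition is the instance at \<open>k + n\<close>.\<close>
        using A[rule_format, of k] A[rule_format, of "k + n"] per[of k] per[of "Suc k"] per[of "Suc (Suc k)"]
        by (cases "c k"; cases "c (Suc k)"; cases "c (Suc (Suc k))") simp
    qed
  next
    assume B: ?B
    show ?A
    proof
      fix k
      show "fits (fst (c (Suc k))) (fst (c k)) (fst (c (Suc (Suc k)))) (snd (c (Suc k)))"
        using B[rule_format, of k]
        by (cases "c k"; cases "c (Suc k)"; cases "c (Suc (Suc k))") simp
    qed
  qed
  finally show ?thesis by (simp add: twisted_def per)
qed

lemma card_guards_unroll: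
  assumes "n > 0" and c: "\<And>k. c k = (L (unroll n k), L (unroll n (k + n)))"
  shows "card {v \<in> pverts (moebius_ladder n). guard (L v)} = (\<Sum>k<n. guards (c k))"
proof -
  have "card {v \<in> pverts (moebius_ladder n). guard (L v)}
      = (\<Sum>v \<in> pverts (moebius_ladder n). of_bool (guard (L v)))"
    by (simp add: moebius_ladder_def Int_def)
  also have "\<dots> = (\<Sum>i \<in> {1..n}. of_bool (guard (L (i, 1))) + of_bool (guard (L (i, 2))))"
    unfolding moebius_ladder_def pair_pre_digraph.simps sum.cartesian_product' by (simp del: sum_of_bool_eq)
  also have "\<dots> = (\<Sum>k<n. of_bool (guard (L (Suc k, 1))) + of_bool (guard (L (Suc k, 2))))"
    by (rule sum.reindex_bij_witness[of _ Suc "\<lambda>i. i - 1"]) auto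
  also have "\<dots> = (\<Sum>k<n. guards (c k))"
    by (rule sum.cong) (simp_all add: c unroll_def)
  finally show ?thesis .
qed

lemma secure_dominating_moebius:
  assumes "n \<ge> 3"
  shows "(\<exists>S. secure_dominating (moebius_ladder n) S \<and> card S = m) \<longleftrightarrow>
         (\<exists>c. twisted n c \<and> (\<Sum>k<n. guards (c k)) = m)" (is "?A \<longleftrightarrow> ?B")
proof
  have n: "n > 0" using assms by simp
  note G = pair_graph_moebius_ladder[OF assms] triangle_free_moebius[OF assms]
  show ?A if B: ?B
  proof -
    obtain c where c: "twisted n c" "(\<Sum>k<n. guards (c k)) = m" using B by blast
    then have per: "c (k + n) = prod.swap (c k)" for k by (simp add: twisted_def)
    have c_mod: "c k = (if even (k div n) then c (k mod n) else prod.swap (c (k mod n)))" for k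
    proof (induction k rule: less_induct)
      case (less k)
      show ?case
      proof (cases "k < n")
        case False
        then have "c k = prod.swap (c (k - n))" using per[of "k - n"] by simp
        with False less[of "k - n"] n show ?thesis
          by (simp add: le_div_geq le_mod_geq)
      qed simp
    qed
    \<comment> \<open>Columns are counted from 0, the rungs of the ladder from 1.\<close>
    define L where "L v = (if snd v = 1 then fst (c (fst v - 1)) else snd (c (fst v - 1)))" for v :: "nat \<times> nat"
    have "L (unroll n k) = fst (c k)" for k
      using c_mod[of k] by (simp add: L_def unroll_def)
    then have cL: "c k = (L (unroll n k), L (unroll n (k + n)))" for k
      by (simp add: per)
    have "role_assignment (moebius_ladder n) L"
      using role_assignment_unroll[of n c L, OF assms cL] c(1) by simp
    then have "secure_dominating (moebius_ladder n) {v \<in> pverts (moebius_ladder n). guard (L v)}"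
      by (rule role_assignment_imp_secure_dominating[OF G])
    moreover have "card {v \<in> pverts (moebius_ladder n). guard (L v)} = m"
      using card_guards_unroll[of n c L, OF n cL] c(2) by simp
    ultimately show ?A by blast
  qed
  show ?B if A: ?A
  proof -
    obtain S where S: "secure_dominating (moebius_ladder n) S" "card S = m" using A by blast
    then obtain L where L: "role_assignment (moebius_ladder n) L"
      "S = {v \<in> pverts (moebius_ladder n). guard (L v)}"
      using secure_dominating_imp_role_assignment[OF G] by blast
    define c where "c k = (L (unroll n k), L (unroll n (k + n)))" for k
    have "twisted n c"
      using role_assignment_unroll[of n c L, OF assms c_def] L(1) by simp
    moreover have "(\<Sum>k<n. guards (c k)) = m"
      using card_guards_unroll[of n c L, OF n c_def] L(2) S(2) by simp
    ultimately show ?B by blast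
  qed
qed

section \<open>Discharging\<close>

text \<open>
  The charge that a vertex sends to its neighbour in an adjacent column; the values solve the linear program
  given by the legal triples of columns. No charge is sent along rungs.
\<close>

fun flow1 :: "role \<Rightarrow> role \<Rightarrow> int" where
  "flow1 Free Shared = 2" | "flow1 Shared Free = -2"
| "flow1 Tied Shared = 1" | "flow1 Shared Tied = -1"
| "flow1 Tied Own = 4" | "flow1 Own Tied = -4"
| "flow1 Own Shared = 1" | "flow1 Shared Own = -1"
| "flow1 _ _ = 0"

fun flow :: "column \<Rightarrow> column \<Rightarrow> int" where
  "flow (a, a') (b, b') = flow1 a b + flow1 a' b'"

text \<open>What the middle column holds beyond its target 6 after receiving charge from
  \<open>a\<close> and sending charge to \<open>c\<close>.\<close>

definition excess :: "column \<Rightarrow> column \<Rightarrow> column \<Rightarrow> int" where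
  "excess a b c = 8 * int (guards b) - 6 + flow a b - flow b c"

lemma flow_swap: "flow (prod.swap a) (prod.swap b) = flow a b"
  by (cases a; cases b) simp

lemma excess_swap: "excess (prod.swap a) (prod.swap b) (prod.swap c) = excess a b c"
  by (simp add: excess_def guards_swap flow_swap)

section \<open>Finite checks and the equality case\<close>

definition tight :: "column \<Rightarrow> column \<Rightarrow> column \<Rightarrow> bool" where
  "tight a b c \<longleftrightarrow> legal a b c \<and> excess a b c = 0"

definition columns :: "column list" where
  "columns = List.product [Free, Tied, Own, Shared] [Free, Tied, Own, Shared]"

text \<open>Turns statements about all columns into list checks that \<open>code_simp\<close> can
  evaluate.\<close>

lemma all_columns: "list_all P columns \<longleftrightarrow> (\<forall>a. P a)"
proof -
  have "(r, r') \<in> set columns" for r r'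
    by (cases r; cases r') (simp_all add: columns_def)
  then show ?thesis by (auto simp: list_all_iff)
qed

text \<open>
  Some legal triples do have negative excess, but none of these extends to five columns.
\<close>

lemma excess_nonneg:
  assumes "legal z a b" "legal a b c" "legal b c d"
  shows "excess a b c \<ge> 0"
proof -
  have "\<forall>a b c. legal a b c \<longrightarrow> excess a b c \<ge> 0 \<or> (\<forall>z. \<not> legal z a b) \<or> (\<forall>d. \<not> legal b c d)"
    unfolding all_columns[symmetric] by code_simp
  from this[rule_format, OF assms(2)] show ?thesis
    using assms(1,3) by metis
qed

text \<open>A prime marks the swapped column; the list is closed under swapping all three
  columns.\<close>

definition tight_triples :: "(column \<times> column \<times> column) list" where
  "tight_triples =
    (let A = (Free, Shared); A' = (Shared, Free); B = (Tied, Shared); B' = (Shared, Tied);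
         P = (Own, Shared); P' = (Shared, Own); BB = (Tied, Tied); PP = (Own, Own); QQ = (Shared, Shared)
     in [(A, B', PP), (A', B, PP), (B', PP, B), (B, PP, B'), (PP, B, A'), (PP, B', A),
         (B, A', B), (B', A, B'), (B, A', P), (B', A, P'), (A', P, BB), (A, P', BB),
         (P, BB, P'), (P', BB, P), (BB, P', A), (BB, P, A'), (P', A, B'), (P, A', B),
         (PP, BB, QQ), (QQ, BB, PP)])"

text \<open>Exhaustive evaluation. Keeping \<open>z\<close> and \<open>d\<close> inside the
  disjunction avoids running through all tuples of five columns.\<close>

lemma tight_triples:
  assumes "tight z a b" "tight a b c" "tight b c d"
  shows "(a, b, c) \<in> set tight_triples"
proof -
  have "\<forall>a b c. tight a b c \<longrightarrow> List.member tight_triples (a, b, c) \<or>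
      (\<forall>z. \<not> tight z a b) \<or> (\<forall>d. \<not> tight b c d)"
    unfolding all_columns[symmetric] by code_simp
  from this[rule_format, OF assms(2)] show ?thesis
    using assms(1,3) unfolding List.member_iff by metis
qed

text \<open>From a free column the list allows only two continuations, one through
  \<open>(Own, Own)\<close> and one through \<open>(Tied, Tied)\<close>; both end in the swapped
  column.\<close>

lemma tight_triples_antiperiodic:
  assumes "(a, b, c) \<in> set tight_triples" "(b, c, d) \<in> set tight_triples"
    "(c, d, e) \<in> set tight_triples" and a: "a = (Free, Shared) \<or> a = (Shared, Free)"
  shows "e = prod.swap a"
proof -
  have "(a, b, c) \<in>
      {((Free, Shared), (Shared, Tied), (Own, Own)), ((Shared, Free), (Tied, Shared), (Own, Own)),
       ((Free, Shared), (Shared, Own), (Tied, Tied)), ((Shared, Free), (Own, Shared), (Tied, Tied))}"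
    using assms(1) a by (elim disjE) (simp_all add: tight_triples_def Let_def)
  then have "(a, c, d) \<in>
      {((Free, Shared), (Own, Own), (Tied, Shared)), ((Shared, Free), (Own, Own), (Shared, Tied)),
       ((Free, Shared), (Tied, Tied), (Own, Shared)), ((Shared, Free), (Tied, Tied), (Shared, Own))}"
    using assms(2) by (elim insertE) (simp_all add: tight_triples_def Let_def)
  then show ?thesis
    using assms(3) by (elim insertE) (simp_all add: tight_triples_def Let_def)
qed

text \<open>Each of the six listed triples without a free column continues only into a free column
  or not at all.\<close>

lemma tight_triples_Free:
  assumes "(a, b, c) \<in> set tight_triples" "(b, c, d) \<in> set tight_triples"
  shows "\<exists>x \<in> {a, b, c, d}. x = (Free, Shared) \<or> x = (Shared, Free)"
proof (rule ccontr)
  assume no: "\<not> ?thesis"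
  then have "(a, b, c) \<in>
      {((Shared, Tied), (Own, Own), (Tied, Shared)), ((Tied, Shared), (Own, Own), (Shared, Tied)),
       ((Own, Shared), (Tied, Tied), (Shared, Own)), ((Shared, Own), (Tied, Tied), (Own, Shared)),
       ((Own, Own), (Tied, Tied), (Shared, Shared)), ((Shared, Shared), (Tied, Tied), (Own, Own))}"
    using assms(1) by (simp add: tight_triples_def Let_def)
  then show False
    using assms(2) no by (elim insertE) (simp_all add: tight_triples_def Let_def)
qed

text \<open>The flow terms telescope, and the two boundary terms cancel because \<open>flow\<close>
  is invariant under the swap after \<open>n\<close> columns.\<close>

lemma sum_excess:
  assumes "twisted n c"
  shows "(\<Sum>k<n. excess (c k) (c (Suc k)) (c (Suc (Suc k)))) = 8 * int (\<Sum>k<n. guards (c k)) - 6 * int n"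
proof -
  have per: "c (k + n) = prod.swap (c k)" for k
    using assms by (simp add: twisted_def)
  have "(\<Sum>k<n. flow (c k) (c (Suc k)) - flow (c (Suc k)) (c (Suc (Suc k))))
      = flow (c 0) (c 1) - flow (c n) (c (Suc n))"
    using sum_lessThan_telescope'[of "\<lambda>k. flow (c k) (c (Suc k))" n] by simp
  also have "\<dots> = 0"
    using per[of 0] per[of 1] by (simp add: flow_swap)
  finally have "(\<Sum>k<n. flow (c k) (c (Suc k)) - flow (c (Suc k)) (c (Suc (Suc k)))) = 0" .
  moreover have "(\<Sum>k<n. int (guards (c (Suc k)))) = (\<Sum>k<n. int (guards (c k)))"
    using sum.lessThan_Suc_shift[of "\<lambda>k. int (guards (c k))" n] per[of 0] by (simp add: guards_swap)
  moreover have "(\<Sum>k<n. excess (c k) (c (Suc k)) (c (Suc (Suc k)))) =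
      8 * (\<Sum>k<n. int (guards (c (Suc k)))) - 6 * int n +
      (\<Sum>k<n. flow (c k) (c (Suc k)) - flow (c (Suc k)) (c (Suc (Suc k))))"
    by (simp add: excess_def sum.distrib sum_subtractf sum_distrib_left)
  ultimately show ?thesis by simp
qed

lemma twisted_excess_nonneg:
  assumes "n > 0" "twisted n c"
  shows "excess (c k) (c (Suc k)) (c (Suc (Suc k))) \<ge> 0"
proof -
  have per: "c (k + n) = prod.swap (c k)" and leg: "legal (c k) (c (Suc k)) (c (Suc (Suc k)))" for k
    using assms by (simp_all add: twisted_def)
  \<comment> \<open>Shifting by a period supplies the preceding column that
    \<open>excess_nonneg\<close> asks for, even when \<open>k\<close> is 0.\<close>
  obtain m where m: "k + n = Suc m" using assms(1) by (cases n) auto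
  have "excess (c (k + n)) (c (Suc k + n)) (c (Suc (Suc k) + n)) \<ge> 0"
    using excess_nonneg[OF leg[of m] leg[of "Suc m"] leg[of "Suc (Suc m)"]] m by simp
  then show ?thesis unfolding per excess_swap .
qed

lemma twisted_lower_bound:
  assumes "n > 0" "twisted n c"
  shows "3 * n \<le> 4 * (\<Sum>k<n. guards (c k))"
proof -
  have "0 \<le> (\<Sum>k<n. excess (c k) (c (Suc k)) (c (Suc (Suc k))))"
    using twisted_excess_nonneg[OF assms] by (intro sum_nonneg) auto
  then show ?thesis unfolding sum_excess[OF assms(2)] by linarith
qed

text \<open>Equality makes every triple tight, so a free column is swapped every four columns. With
  \<open>n = 4 * m\<close> it is swapped \<open>m\<close> times, which must amount to a single
  swap.\<close>

lemma twisted_tight: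
  assumes n: "n > 0" and c: "twisted n c" and eq: "4 * (\<Sum>k<n. guards (c k)) = 3 * n"
  shows "n mod 8 = 4"
proof -
  have per: "c (k + n) = prod.swap (c k)" and leg: "legal (c k) (c (Suc k)) (c (Suc (Suc k)))" for k
    using c by (simp_all add: twisted_def)
  let ?e = "\<lambda>k. excess (c k) (c (Suc k)) (c (Suc (Suc k)))"
  have "(\<Sum>k<n. ?e k) = 0"
    unfolding sum_excess[OF c] using eq by linarith
  then have zero: "?e k = 0" if "k < n" for k
    using twisted_excess_nonneg[OF n c] that by (subst (asm) sum_nonneg_eq_0_iff) auto
  have "?e k = 0" for k
  proof (induction k rule: less_induct)
    case (less k)
    show ?case
    proof (cases "k < n")
      case False
      then obtain m where m: "k = m + n" by (metis add.commute le_Suc_ex not_less)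
      have "?e (m + n) = ?e m"
        using per[of m] per[of "Suc m"] per[of "Suc (Suc m)"] by (simp add: excess_swap)
      with less[of m] m n show ?thesis by simp
    qed (use zero in simp)
  qed
  then have tight: "tight (c k) (c (Suc k)) (c (Suc (Suc k)))" for k
    using leg by (simp add: tight_def)
  have tri: "(c (Suc k), c (Suc (Suc k)), c (Suc (Suc (Suc k)))) \<in> set tight_triples" for k
    using tight_triples tight by blast
  let ?F = "\<lambda>k. c (Suc k) = (Free, Shared) \<or> c (Suc k) = (Shared, Free)"
  have step: "c (Suc k + 4) = prod.swap (c (Suc k))" if "?F k" for k
    using tight_triples_antiperiodic[OF tri[of k] tri[of "Suc k"] tri[of "Suc (Suc k)"]] that
    by (simp add: eval_nat_numeral)
  obtain k where k: "?F k"
    using tight_triples_Free[OF tri[of 0] tri[of "Suc 0"]] by auto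
  have run: "c (Suc (k + 4 * m)) = (prod.swap ^^ m) (c (Suc k)) \<and> ?F (k + 4 * m)" for m
  proof (induction m)
    case (Suc m)
    have "c (Suc (k + 4 * m) + 4) = prod.swap (c (Suc (k + 4 * m)))"
      using Suc by (intro step) blast
    moreover have "Suc (k + 4 * Suc m) = Suc (k + 4 * m) + 4" by simp
    ultimately have "c (Suc (k + 4 * Suc m)) = prod.swap (c (Suc (k + 4 * m)))" by metis
    moreover from this have "?F (k + 4 * Suc m)"
      using conjunct2[OF Suc] by (elim disjE) (simp_all del: mult_Suc_right)
    ultimately show ?case using Suc by (simp del: mult_Suc_right)
  qed (use k in simp)
  have "4 dvd n"
    using eq by presburger
  then obtain m where m: "n = 4 * m" by blast
  have "c (Suc k + n) = (prod.swap ^^ m) (c (Suc k))" using run[of m] m by simp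
  then have swap_m: "(prod.swap ^^ m) (c (Suc k)) = prod.swap (c (Suc k))" using per[of "Suc k"] by simp
  have "odd m"
  proof
    assume "even m"
    moreover have "(prod.swap ^^ (2 * l)) (c (Suc k)) = c (Suc k)" for l
      by (induction l) simp_all
    ultimately have "(prod.swap ^^ m) (c (Suc k)) = c (Suc k)"
      by (metis evenE)
    \<comment> \<open>A free column differs from its own swap.\<close>
    then show False using swap_m k by auto
  qed
  then show ?thesis using m by presburger
qed

section \<open>Construction\<close>

fun legal_walk :: "column list \<Rightarrow> bool" where
  "legal_walk (a # b # c # w) \<longleftrightarrow> legal a b c \<and> legal_walk (b # c # w)"
| "legal_walk _ \<longleftrightarrow> True"

lemma legal_walk_swap: "legal_walk (map prod.swap w) \<longleftrightarrow> legal_walk w"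
  by (induction w rule: legal_walk.induct) (simp_all add: legal_swap)

lemma legal_walk_nth:
  assumes "legal_walk w" "Suc (Suc i) < length w"
  shows "legal (w ! i) (w ! Suc i) (w ! Suc (Suc i))"
  using assms by (induction w arbitrary: i rule: legal_walk.induct) (auto simp: less_Suc_eq_0_disj)

text \<open>The two appended columns begin the next, swapped period, so the walk also checks the
  triples across the seam.\<close>

lemma twisted_of_legal_walk:
  assumes walk: "legal_walk (w @ [prod.swap (w ! 0), prod.swap (w ! 1)])" and n: "length w = n" "n \<ge> 2"
  shows "\<exists>c. twisted n c \<and> (\<Sum>k<n. guards (c k)) = sum_list (map guards w)"
proof -
  define c where "c k = (prod.swap ^^ (k div n)) (w ! (k mod n))" for k
  let ?w = "w @ [prod.swap (w ! 0), prod.swap (w ! 1)]"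
  have legal_swaps: "legal ((prod.swap ^^ q) x) ((prod.swap ^^ q) y) ((prod.swap ^^ q) z) \<longleftrightarrow> legal x y z" for q x y z
    by (induction q) (simp_all add: legal_swap)
  have c_walk: "c (q * n + i) = (prod.swap ^^ q) (?w ! i)" if i: "i < n + 2" for q i
  proof (cases "i < n")
    case True
    then show ?thesis using n by (simp add: c_def nth_append)
  next
    case False
    with i obtain j where j: "i = n + j" "j < 2"
      by (metis add.commute add_less_cancel_right le_add_diff_inverse2 not_less)
    have "c (q * n + i) = c (j + Suc q * n)" using j by (simp add: ac_simps)
    also have "\<dots> = (prod.swap ^^ Suc q) (w ! j)"
      unfolding c_def using n j(2) by (subst div_mult_self1, simp, subst mod_mult_self1) simp
    also have "\<dots> = (prod.swap ^^ q) (?w ! i)"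
      using j n by (auto simp: nth_append less_2_cases_iff funpow_swap1)
    finally show ?thesis .
  qed
  have "legal (c k) (c (Suc k)) (c (Suc (Suc k)))" for k
  proof -
    define q i where "q = k div n" and "i = k mod n"
    have k: "k = q * n + i" and i: "i < n" using n by (simp_all add: q_def i_def)
    have "legal (?w ! i) (?w ! Suc i) (?w ! Suc (Suc i))"
      using legal_walk_nth[OF walk, of i] i n by simp
    then have "legal (c (q * n + i)) (c (q * n + Suc i)) (c (q * n + Suc (Suc i)))"
      using i by (simp only: c_walk legal_swaps)
    then show ?thesis by (simp add: k)
  qed
  moreover have "c (k + n) = prod.swap (c k)" for k
    using n by (simp add: c_def)
  ultimately have "twisted n c" by (simp add: twisted_def)
  moreover have "(\<Sum>k<n. guards (c k)) = sum_list (map guards w)"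
    using n by (simp add: sum_list_sum_nth c_def atLeast0LessThan)
  ultimately show ?thesis by blast
qed

text \<open>A checkerboard of \<open>Free\<close> and \<open>Shared\<close>.\<close>

fun free_run :: "nat \<Rightarrow> column list" where
  "free_run 0 = []"
| "free_run (Suc r) = (Free, Shared) # map prod.swap (free_run r)"

text \<open>
  With guards drawn as \<open>#\<close>, a block consists of the columns \<open># . . #\<close> over \<open>. # . .\<close>; the next block has the
  two rows exchanged. Free columns fill up the remaining length.
\<close>

fun word :: "nat \<Rightarrow> nat \<Rightarrow> column list" where
  "word 0 r = free_run r"
| "word (Suc q) r = [(Free, Shared), (Shared, Tied), (Own, Own), (Tied, Shared)] @ map prod.swap (word q r)"

lemma length_word: "length (word q r) = 4 * q + r"
proof -
  have "length (free_run r) = r" by (induction r) simp_all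
  then show ?thesis by (induction q) simp_all
qed

lemma guards_word: "sum_list (map guards (word q r)) = 3 * q + r"
proof -
  have "sum_list (map guards (free_run r)) = r"
    by (induction r) (simp_all add: comp_def guards_swap)
  then show ?thesis by (induction q) (simp_all add: comp_def guards_swap)
qed

text \<open>\<open>e\<close> stands for the first two columns of the next block, in either
  orientation. Without free filler columns, parity decides which one fits. The second conjunct
  strengthens the induction: putting a block in front creates triples that reach two columns into
  the rest.\<close>

lemma legal_walk_word:
  assumes "e = [(Free, Shared), (Shared, Tied)] \<or> e = [(Shared, Free), (Tied, Shared)]"
    and "1 \<le> r \<and> r \<le> 4 \<or> r = 0 \<and> (e = [(Free, Shared), (Shared, Tied)] \<longleftrightarrow> even q)"
  shows "legal_walk (word q r @ e) \<and>
    (\<exists>b w. word q r @ e = (Free, Shared) # b # w \<and> b \<in> {(Free, Shared), (Shared, Free), (Shared, Tied)})"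
  using assms
proof (induction q arbitrary: e)
  case 0
  then consider "r = 0" "e = [(Free, Shared), (Shared, Tied)]" | "r = 1" | "r = 2" | "r = 3" | "r = 4"
    by (cases "r = 0") (simp, linarith)
  then show ?case
    using 0(1) by cases (auto simp: eval_nat_numeral exactly_one_def)
next
  case (Suc q)
  have "legal_walk (word q r @ map prod.swap e) \<and>
    (\<exists>b w. word q r @ map prod.swap e = (Free, Shared) # b # w \<and> b \<in> {(Free, Shared), (Shared, Free), (Shared, Tied)})"
    \<comment> \<open>Dropping a block swaps \<open>e\<close> and flips the parity of the number of
      blocks.\<close>
    using Suc.prems by (intro Suc.IH) auto
  then obtain b w where w: "word q r @ map prod.swap e = (Free, Shared) # b # w"
    "b \<in> {(Free, Shared), (Shared, Free), (Shared, Tied)}" "legal_walk ((Free, Shared) # b # w)"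
    by auto
  have "word (Suc q) r @ e = [(Free, Shared), (Shared, Tied), (Own, Own), (Tied, Shared)]
      @ map prod.swap (word q r @ map prod.swap e)"
    by (simp add: comp_def)
  also have "\<dots> = (Free, Shared) # (Shared, Tied) # (Own, Own) # (Tied, Shared) #
      map prod.swap ((Free, Shared) # b # w)"
    unfolding w(1) by simp
  finally have eq: "word (Suc q) r @ e = \<dots>" .
  show ?case
    unfolding eq using w(2) legal_walk_swap[of "(Free, Shared) # b # w"] w(3)
    by (auto simp: exactly_one_def)
qed

text \<open>With \<open>n = 4 * q + r\<close> the word has \<open>3 * q + r\<close> guards, so four
  times their number is \<open>3 * n + r\<close>. Taking \<open>r = 0\<close> meets the twist only
  for an odd number of blocks.\<close>

lemma twisted_upper_bound:
  assumes "n \<ge> 3"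
  shows "\<exists>c. twisted n c \<and> 4 * (\<Sum>k<n. guards (c k)) \<le> 3 * n + 4 \<and>
    (n mod 8 = 4 \<longrightarrow> 4 * (\<Sum>k<n. guards (c k)) = 3 * n)"
proof -
  have *: ?thesis
    if walk: "legal_walk (word q r @ [prod.swap (word q r ! 0), prod.swap (word q r ! 1)])"
      and n: "n = 4 * q + r" and r: "r \<le> 4" and "n mod 8 = 4 \<longrightarrow> r = 0" for q r
    using twisted_of_legal_walk[OF walk length_word] that assms unfolding guards_word by fastforce
  have **: ?thesis if "n = 4 * Suc q + r" "1 \<le> r \<and> r \<le> 4 \<or> r = 0 \<and> even q" "n mod 8 = 4 \<longrightarrow> r = 0" for q r
  proof (rule *)
    show "legal_walk (word (Suc q) r @ [prod.swap (word (Suc q) r ! 0), prod.swap (word (Suc q) r ! 1)])"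
      \<comment> \<open>This \<open>e\<close> is the swapped start of the word itself.\<close>
      using legal_walk_word[of "[(Shared, Free), (Tied, Shared)]" r "Suc q"] that(2) by simp
    show "r \<le> 4" using that(2) by linarith
  qed (fact that)+
  show ?thesis
  proof (cases "n = 3")
    case True
    have "word 0 3 = [(Free, Shared), (Shared, Free), (Free, Shared)]"
      by (simp add: numeral_3_eq_3)
    then show ?thesis
      by (intro *[of 0 3]) (simp_all add: True)
  next
    case False
    show ?thesis
    proof (cases "8 dvd n")
      case True
      then obtain m where m: "n = 8 * m" by blast
      with assms obtain m' where "m = Suc m'" by (cases m) auto
      \<comment> \<open>An even number of blocks would not close up, so four free columns replace
        one block.\<close>
      with m show ?thesis by (intro **[of "2 * m'" 4]) simp_all
    next
      case not8: False
      have "n div 4 \<noteq> 0" using False assms by (simp add: div_eq_0_iff)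
      then obtain q where q: "n div 4 = Suc q" by (cases "n div 4") auto
      define r where "r = n mod 4"
      have n: "n = 4 * Suc q + r" and "r < 4"
        using div_mult_mod_eq[of n 4] q by (simp_all add: r_def)
      show ?thesis
      proof (rule **[OF n])
        have "even q" if "r = 0"
        proof (rule ccontr)
          assume "odd q"
          then obtain p where "q = Suc (2 * p)" by (auto elim: oddE)
          with n that have "n = 8 * (p + 1)" by simp
          with not8 show False by (metis dvd_triv_left)
        qed
        with \<open>r < 4\<close> show "1 \<le> r \<and> r \<le> 4 \<or> r = 0 \<and> even q" by auto
        have "n mod 8 mod 4 = r" by (simp add: r_def mod_mod_cancel)
        then show "n mod 8 = 4 \<longrightarrow> r = 0" by auto
      qed
    qed
  qed
qed

section \<open>The secure domination number\<close>

theorem theorem22: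
  fixes n :: nat
  assumes "n \<ge> 3"
  shows "real (secure_domination_number (moebius_ladder n)) =
    (if n mod 8 = 4 then 3 * real n / 4 else real_of_int \<lceil>(3 * real n + 1) / 4\<rceil>)"
proof -
  define s where "s = secure_domination_number (moebius_ladder n)"
  have n: "n > 0" using assms by simp
  obtain c where c: "twisted n c" "(\<Sum>k<n. guards (c k)) = s"
    using secure_domination_number_attained[of "moebius_ladder n"]
    unfolding secure_dominating_moebius[OF assms] s_def by blast
  have lower: "3 * n \<le> 4 * s" "4 * s = 3 * n \<Longrightarrow> n mod 8 = 4"
    using twisted_lower_bound[OF n c(1)] twisted_tight[OF n c(1)] c(2) by simp_all
  obtain d m where d: "twisted n d" "(\<Sum>k<n. guards (d k)) = m"
    and m: "4 * m \<le> 3 * n + 4" "n mod 8 = 4 \<longrightarrow> 4 * m = 3 * n"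
    using twisted_upper_bound[OF assms] by blast
  have "\<exists>S. secure_dominating (moebius_ladder n) S \<and> card S = m"
    unfolding secure_dominating_moebius[OF assms] using d by blast
  then have "s \<le> m"
    unfolding s_def secure_domination_number_def by (rule Least_le)
  show ?thesis
  proof (cases "n mod 8 = 4")
    case True
    then have "4 * s = 3 * n" using lower(1) m(2) \<open>s \<le> m\<close> by simp
    then have "4 * real s = 3 * real n" by linarith
    then show ?thesis using True by (simp add: s_def)
  next
    case False
    then have "4 * s \<noteq> 3 * n" using lower(2) by blast
    \<comment> \<open>Excluding equality gains 1 by integrality; the two bounds then leave one
      integer, the ceiling.\<close>
    then have "3 * n + 1 \<le> 4 * s" "4 * s \<le> 3 * n + 4"
      using lower(1) m(1) \<open>s \<le> m\<close> by linarith+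
    then have "3 * real n + 1 \<le> 4 * real s" "4 * real s \<le> 3 * real n + 4"
      by linarith+
    then have "\<lceil>(3 * real n + 1) / 4\<rceil> = int s"
      by (intro ceiling_unique) simp_all
    then show ?thesis using False by (simp add: s_def)
  qed
qed

end
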